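(* Let $\Gamma=(G,\sigma)$ be a connected signed graph, let $uv$ be a non-pendant edge of $\Gamma$ that lies in no triangle, and let $\Gamma'=\alpha(\Gamma,uv)$ be the graph obtained from $\Gamma$ by the $\alpha$-transform on the edge $uv$. Let $\mathbf x$ be an eigenvector of $A(\Gamma)$ corresponding to the index $\lambda(\Gamma)$. If one of the following conditions holds, then $\lambda(\Gamma')\ge\lambda(\Gamma)$: (1) $\sigma(uv)>0$ and $x_v\le x_u\le\lambda(\Gamma)x_v$; (2) $\sigma(uv)<0$ and $x_u\ge 0$, $x_v\ge 0$. Furthermore, if one of the following conditions holds, then $\lambda(\Gamma')>\lambda(\Gamma)$: (1) $\sigma(uv)>0$ and $x_v<x_u<\lambda(\Gamma)x_v$; (2) $\sigma(uv)<0$, $x_u>0$, $x_v>0$ and $x_u\ne x_v$.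
   Context: A signed graph $\Gamma=(G,\sigma)$ is a finite simple graph $G$ with a map $\sigma:E(G)\to\{+1,-1\}$. Its adjacency matrix $A(\Gamma)$ has $(u,v)$ entry $\sigma(uv)$ if $uv\in E(G)$ and $0$ otherwise; the index $\lambda(\Gamma)$ is the largest eigenvalue of $A(\Gamma)$. For a vector $\mathbf x$ indexed by vertices, $x_u$ is its entry at $u$. $\alpha$-transform: let $\Gamma$ be a connected signed graph and $uv$ a non-pendant edge (neither end has degree 1) which is not in any triangle. Let $N_\Gamma(v)\setminus\{u\}=\{v_1,\dots,v_d\}$ with $d\ge 1$. Then $$\alpha(\Gamma,uv)=\Gamma-vv_1-\cdots-vv_d+uv_1+\cdots+uv_d,$$ where all edges retain their signs (the new edge $uv_i$ has sign $\sigma(vv_i)$; the edge $uv$ is kept with its sign). *)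

theory Defs
  imports "HOL-Analysis.Analysis"
begin

text \<open>The vertex set is the whole (finite) type \<open>'v\<close>; an edge is a two-element set of vertices.
  The values of \<open>esign\<close> outside \<open>edges\<close> are irrelevant.\<close>

record 'v signed_graph =
  edges :: "'v set set"
  esign :: "'v set \<Rightarrow> int"

definition is_signed_graph :: "'v::finite signed_graph \<Rightarrow> bool" where
  "is_signed_graph \<Gamma> \<longleftrightarrow>
     (\<forall>e \<in> edges \<Gamma>. card e = 2) \<and> (\<forall>e \<in> edges \<Gamma>. esign \<Gamma> e \<in> {1, -1})"

definition neighbours :: "'v::finite signed_graph \<Rightarrow> 'v \<Rightarrow> 'v set" where
  "neighbours \<Gamma> v = {w. {v, w} \<in> edges \<Gamma>}"

definition degree :: "'v::finite signed_graph \<Rightarrow> 'v \<Rightarrow> nat" where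
  "degree \<Gamma> v = card (neighbours \<Gamma> v)"

definition connected_graph :: "'v::finite signed_graph \<Rightarrow> bool" where
  "connected_graph \<Gamma> \<longleftrightarrow> (\<forall>a b. (a, b) \<in> {(p, q). {p, q} \<in> edges \<Gamma>}\<^sup>*)"

definition pendant_edge :: "'v::finite signed_graph \<Rightarrow> 'v \<Rightarrow> 'v \<Rightarrow> bool" where
  "pendant_edge \<Gamma> u v \<longleftrightarrow> {u, v} \<in> edges \<Gamma> \<and> (degree \<Gamma> u = 1 \<or> degree \<Gamma> v = 1)"

definition in_triangle :: "'v::finite signed_graph \<Rightarrow> 'v \<Rightarrow> 'v \<Rightarrow> bool" where
  "in_triangle \<Gamma> u v \<longleftrightarrow>
     {u, v} \<in> edges \<Gamma> \<and> (\<exists>w. {u, w} \<in> edges \<Gamma> \<and> {v, w} \<in> edges \<Gamma>)"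

definition adj_matrix :: "'v::finite signed_graph \<Rightarrow> real ^ 'v ^ 'v" where
  "adj_matrix \<Gamma> =
     (\<chi> a b. if {a, b} \<in> edges \<Gamma> then of_int (esign \<Gamma> {a, b}) else 0)"

definition eigenvector :: "real ^ 'v ^ 'v \<Rightarrow> real ^ 'v::finite \<Rightarrow> real \<Rightarrow> bool" where
  "eigenvector A x k \<longleftrightarrow> x \<noteq> 0 \<and> A *v x = k *\<^sub>R x"

definition eigenvalue :: "real ^ 'v ^ 'v::finite \<Rightarrow> real \<Rightarrow> bool" where
  "eigenvalue A k \<longleftrightarrow> (\<exists>x. eigenvector A x k)"

text \<open>The adjacency matrix of a signed graph is real symmetric, so the set of its real
  eigenvalues is finite and nonempty, contains all its eigenvalues, and \<^const>\<open>Max\<close> is meaningful.\<close>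

definition graph_index :: "'v::finite signed_graph \<Rightarrow> real" where
  "graph_index \<Gamma> = Max {k. eigenvalue (adj_matrix \<Gamma>) k}"

text \<open>Every edge \<open>{v, w}\<close> with \<open>w \<noteq> u\<close> is replaced by \<open>{u, w}\<close>, and this new edge \<open>e = {u, w}\<close> takes
  the sign of \<open>insert v (e - {u}) = {v, w}\<close>. Since \<open>{u, v}\<close> is in no triangle, \<open>{u, w}\<close> was not
  an edge before.\<close>

definition alpha :: "'v::finite signed_graph \<Rightarrow> 'v \<Rightarrow> 'v \<Rightarrow> 'v signed_graph" where
  "alpha \<Gamma> u v =
     \<lparr> edges = (edges \<Gamma> - {{v, w} | w. w \<in> neighbours \<Gamma> v - {u}})
                 \<union> {{u, w} | w. w \<in> neighbours \<Gamma> v - {u}},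
       esign = (\<lambda>e. if \<exists>w \<in> neighbours \<Gamma> v - {u}. e = {u, w}
                    then esign \<Gamma> (insert v (e - {u})) else esign \<Gamma> e) \<rparr>"

end

(* Let s be row v of A = A(\<Gamma>) with the entry at u removed and w = e_u - e_v. As uv lies in no
   triangle, A(\<Gamma>') = A + w s\<^sup>T + s w\<^sup>T, so y \<bullet> A(\<Gamma>') y = y \<bullet> A y + 2 (y_u - y_v) ((A y)_v - \<sigma>(uv) y_u)
   for every y. Substituting the given eigenvector x, or the vector obtained from x by swapping its
   entries at u and v (needed when \<sigma>(uv) < 0 and x_u < x_v), yields a vector with the norm of x
   whose quadratic form is at least \<lambda>(\<Gamma>) |x|\<^sup>2, and the Rayleigh bound for \<lambda>(\<Gamma>') concludes. *)

theory Submission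
  imports Defs
begin

section \<open>Spectral facts on real symmetric matrices\<close>

lemma symmetric_matrix_inner:
  fixes A :: "real ^ 'n ^ 'n"
  assumes "transpose A = A"
  shows "x \<bullet> (A *v y) = y \<bullet> (A *v x)"
  using assms by (metis dot_lmul_matrix inner_commute transpose_matrix_vector)

text \<open>Eigenvectors for distinct eigenvalues are orthogonal, and a pairwise orthogonal set in a
  Euclidean space is finite. Finiteness is what makes the \<open>Max\<close> in
  \<open>graph_index\<close> an upper bound.\<close>

lemma symmetric_finite_eigenvalues:
  fixes A :: "real ^ 'n ^ 'n"
  assumes sym: "transpose A = A"
  shows "finite {k. eigenvalue A k}"
proof -
  define f where "f k = (SOME x. eigenvector A x k)" for k
  have f: "f k \<noteq> 0" "A *v f k = k *\<^sub>R f k" if "eigenvalue A k" for k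
    using someI_ex[of "\<lambda>x. eigenvector A x k"] that
    unfolding f_def eigenvalue_def eigenvector_def by auto
  have orth: "f k \<bullet> f l = 0" if "eigenvalue A k" "eigenvalue A l" "k \<noteq> l" for k l
  proof -
    have "k * (f l \<bullet> f k) = l * (f k \<bullet> f l)"
      using symmetric_matrix_inner[OF sym, of "f l" "f k"] f that by simp
    then show ?thesis using that by (simp add: inner_commute)
  qed
  \<comment> \<open>A common value of \<open>f\<close> at two distinct eigenvalues would be
    orthogonal to itself, hence 0.\<close>
  have "inj_on f {k. eigenvalue A k}"
    by (rule inj_onI) (metis f(1) orth inner_eq_zero_iff mem_Collect_eq)
  moreover have "finite (f ` {k. eigenvalue A k})"
    by (rule pairwise_orthogonal_imp_finite)
      (auto simp: pairwise_def orthogonal_def intro!: orth)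
  ultimately show ?thesis by (rule finite_imageD[rotated])
qed

text \<open>By compactness the quadratic form attains its maximum \<open>k\<close> on the unit
  sphere, and the first-order condition at a maximiser \<open>z\<close> says that \<open>z\<close>
  is an eigenvector for \<open>k\<close>.\<close>

lemma symmetric_top_eigenvalue:
  fixes A :: "real ^ 'n ^ 'n"
  assumes sym: "transpose A = A"
  obtains k where "eigenvalue A k" "\<And>y. y \<bullet> (A *v y) \<le> k * (y \<bullet> y)"
proof -
  let ?S = "sphere (0 :: real ^ 'n) 1"
  have "axis undefined 1 \<in> ?S" by simp
  then have "?S \<noteq> {}" by blast
  moreover have "continuous_on ?S (\<lambda>y. y \<bullet> (A *v y))"
    by (intro continuous_intros)
  ultimately obtain z where z: "z \<in> ?S"
    and max: "\<And>y. y \<in> ?S \<Longrightarrow> y \<bullet> (A *v y) \<le> z \<bullet> (A *v z)"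
    using continuous_attains_sup[OF compact_sphere, of 0 1 "\<lambda>y. y \<bullet> (A *v y)"] by blast
  define k where "k = z \<bullet> (A *v z)"
  have le: "y \<bullet> (A *v y) \<le> k * (y \<bullet> y)" for y
  proof (cases "y = 0")
    case False
    define c where "c = norm y"
    have "c > 0" using False by (simp add: c_def)
    have "(1 / c) *\<^sub>R y \<in> ?S" using False by (simp add: c_def)
    from max[OF this] have "(y \<bullet> (A *v y)) / c\<^sup>2 \<le> k"
      by (simp add: k_def matrix_vector_mult_scaleR power2_eq_square)
    then show ?thesis
      using \<open>c > 0\<close> by (simp add: c_def field_simps flip: power2_norm_eq_inner)
  qed simp
  \<comment> \<open>\<open>r\<close> is the gradient at \<open>z\<close> of \<open>k (y \<bullet> y) - y \<bullet> A y\<close> (up to a factor 2), which is minimal there.\<close>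
  define r where "r = k *\<^sub>R z - A *v z"
  define q where "q = k * (r \<bullet> r) - r \<bullet> (A *v r)"
  have zz: "z \<bullet> z = 1" using z by (simp add: norm_eq_1)
  \<comment> \<open>The form \<open>k (y \<bullet> y) - y \<bullet> A y\<close>, nonnegative by
    \<open>le\<close>, is evaluated at \<open>y = z - t r\<close>: it vanishes at \<open>z\<close>,
    its linear term is \<open>- 2 t (r \<bullet> r)\<close>, and \<open>q\<close> is its value at
    \<open>r\<close>.\<close>
  have expand: "0 \<le> q * t\<^sup>2 - 2 * t * (r \<bullet> r)" for t :: real
  proof -
    have rr: "r \<bullet> r = k * (z \<bullet> r) - z \<bullet> (A *v r)"
      using symmetric_matrix_inner[OF sym, of z r]
      by (metis r_def inner_commute inner_diff_right inner_scaleR_right)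
    have "(z - t *\<^sub>R r) \<bullet> (A *v (z - t *\<^sub>R r)) = k - 2 * t * (z \<bullet> (A *v r)) + t\<^sup>2 * (r \<bullet> (A *v r))"
      using symmetric_matrix_inner[OF sym, of z r]
      by (simp add: k_def matrix_vector_mult_diff_distrib matrix_vector_mult_scaleR inner_diff
          power2_eq_square algebra_simps)
    moreover have "(z - t *\<^sub>R r) \<bullet> (z - t *\<^sub>R r) = 1 - 2 * t * (z \<bullet> r) + t\<^sup>2 * (r \<bullet> r)"
      by (simp add: zz inner_diff inner_commute power2_eq_square algebra_simps)
    ultimately have "k - 2 * t * (z \<bullet> (A *v r)) + t\<^sup>2 * (r \<bullet> (A *v r))
        \<le> k * (1 - 2 * t * (z \<bullet> r) + t\<^sup>2 * (r \<bullet> r))"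
      using le[of "z - t *\<^sub>R r"] by simp
    also have "k * (1 - 2 * t * (z \<bullet> r) + t\<^sup>2 * (r \<bullet> r))
        = k - 2 * t * (z \<bullet> (A *v r)) + t\<^sup>2 * (r \<bullet> (A *v r))
          + (q * t\<^sup>2 - 2 * t * (k * (z \<bullet> r) - z \<bullet> (A *v r)))"
      by (simp add: q_def algebra_simps)
    finally show ?thesis unfolding rr by simp
  qed
  have "r \<bullet> r = 0"
  proof (rule ccontr)
    assume "r \<bullet> r \<noteq> 0"
    then have pos: "r \<bullet> r > 0" using inner_ge_zero[of r] by linarith
    \<comment> \<open>A step so short that the linear term wins: \<open>q t\<close> is at most
      \<open>r \<bullet> r\<close>, whereas \<open>expand\<close> demands at least twice that. The
      summand 1 keeps the denominator positive when \<open>q = 0\<close>.\<close>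
    define t where "t = (r \<bullet> r) / (\<bar>q\<bar> + 1)"
    have t: "t > 0" "t * (\<bar>q\<bar> + 1) = r \<bullet> r" using pos by (auto simp: t_def)
    have "0 \<le> t * (q * t - 2 * (r \<bullet> r))"
      using expand[of t] by (simp add: power2_eq_square algebra_simps)
    then have "2 * (r \<bullet> r) \<le> q * t" using t(1) by (simp add: zero_le_mult_iff)
    also have "\<dots> \<le> t * (\<bar>q\<bar> + 1)"
      using t(1) mult_left_mono[of q "\<bar>q\<bar> + 1" t] by (simp add: mult.commute)
    finally show False using t pos by simp
  qed
  then have "eigenvector A z k" using zz by (auto simp: eigenvector_def r_def)
  then show thesis using that le eigenvalue_def by blast
qed

section \<open>The index as the maximum of the Rayleigh quotient\<close>

lemma adj_matrix_symmetric: "transpose (adj_matrix \<Gamma>) = adj_matrix \<Gamma>"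
  by (simp add: adj_matrix_def transpose_def vec_eq_iff insert_commute)

text \<open>The constant in the Rayleigh bound is itself an eigenvalue, so it is at most the largest
  one. A lower bound on the index of the transformed graph thus needs only a test vector.\<close>

lemma rayleigh_le_graph_index:
  "y \<bullet> (adj_matrix \<Gamma> *v y) \<le> graph_index \<Gamma> * (y \<bullet> y)"
proof -
  obtain k where k: "eigenvalue (adj_matrix \<Gamma>) k"
    and le: "y \<bullet> (adj_matrix \<Gamma> *v y) \<le> k * (y \<bullet> y)"
    using symmetric_top_eigenvalue[OF adj_matrix_symmetric] by metis
  have "k \<le> graph_index \<Gamma>"
    unfolding graph_index_def using k
    by (intro Max_ge symmetric_finite_eigenvalues adj_matrix_symmetric) simp
  then show ?thesis using le by (meson inner_ge_zero mult_right_mono order_trans)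
qed

lemma no_loop: "is_signed_graph \<Gamma> \<Longrightarrow> {a, a} \<notin> edges \<Gamma>"
  by (fastforce simp: is_signed_graph_def)

lemma adj_matrix_diag: "is_signed_graph \<Gamma> \<Longrightarrow> adj_matrix \<Gamma> $ a $ a = 0"
  using no_loop[of \<Gamma> a] by (simp add: adj_matrix_def)

text \<open>A standard basis vector has Rayleigh quotient equal to a diagonal entry, which is 0. The
  sign of the index matters when \<open>uv\<close> is negative.\<close>

lemma graph_index_nonneg:
  assumes "is_signed_graph \<Gamma>"
  shows "graph_index \<Gamma> \<ge> 0"
  using rayleigh_le_graph_index[of "axis undefined 1" \<Gamma>] adj_matrix_diag[OF assms]
  by (simp add: inner_axis_axis inner_axis' matrix_vector_mult_basis column_def)

section \<open>The adjacency matrix and quadratic form of the transformed graph\<close>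

lemma alpha_edge_iff:
  assumes "u \<noteq> v" "{v, v} \<notin> edges \<Gamma>" "\<not> in_triangle \<Gamma> u v" "{u, v} \<in> edges \<Gamma>"
  shows "{a, b} \<in> edges (alpha \<Gamma> u v) \<longleftrightarrow>
    (if a = u then {u, b} \<in> edges \<Gamma> \<or> {v, b} \<in> edges \<Gamma> \<and> b \<noteq> u
     else if b = u then {u, a} \<in> edges \<Gamma> \<or> {v, a} \<in> edges \<Gamma>
     else a \<noteq> v \<and> b \<noteq> v \<and> {a, b} \<in> edges \<Gamma>)"
  using assms
  by (auto simp: alpha_def neighbours_def in_triangle_def doubleton_eq_iff insert_commute)

lemma alpha_esign:
  assumes "u \<noteq> v"
  shows "esign (alpha \<Gamma> u v) {a, b} =
    (if a = u \<and> b \<noteq> u \<and> {v, b} \<in> edges \<Gamma> then esign \<Gamma> {v, b}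
     else if b = u \<and> a \<noteq> u \<and> {v, a} \<in> edges \<Gamma> then esign \<Gamma> {v, a}
     else esign \<Gamma> {a, b})"
proof -
  \<comment> \<open>Recovers from a moved edge the old edge that supplies its sign.\<close>
  have "insert v ({u, c} - {u}) = {v, c}" "insert v ({c, u} - {u}) = {v, c}" if "c \<noteq> u" for c
    using that by auto
  then show ?thesis
    by (auto simp: alpha_def neighbours_def doubleton_eq_iff)
qed

text \<open>The vector \<open>s\<close> lists the signs of the edges to be moved. The two rank-one
  terms add it to row and column \<open>u\<close> and subtract it from row and column
  \<open>v\<close>. Since \<open>u\<close> and \<open>v\<close> have no common neighbour, the added
  signs only meet zero entries.\<close>

lemma adj_matrix_alpha:
  fixes \<Gamma> :: "'v::finite signed_graph"
  assumes sg: "is_signed_graph \<Gamma>" and uv: "{u, v} \<in> edges \<Gamma>" and tri: "\<not> in_triangle \<Gamma> u v"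
  defines "s \<equiv> row v (adj_matrix \<Gamma>) - of_int (esign \<Gamma> {u, v}) *\<^sub>R axis u 1"
    and "w \<equiv> axis u 1 - axis v 1 :: real ^ 'v"
  shows "adj_matrix (alpha \<Gamma> u v) $ a $ b = adj_matrix \<Gamma> $ a $ b + w $ a * s $ b + s $ a * w $ b"
proof -
  have loops: "{c, c} \<notin> edges \<Gamma>" for c using no_loop[OF sg] .
  then have ne: "u \<noteq> v" using uv by auto
  have vu: "{v, u} \<in> edges \<Gamma>" using uv by (simp add: insert_commute)
  have tri': "\<not> ({u, c} \<in> edges \<Gamma> \<and> {v, c} \<in> edges \<Gamma>)" for c
    using tri uv by (auto simp: in_triangle_def)
  have s: "s $ c = (if {v, c} \<in> edges \<Gamma> \<and> c \<noteq> u then of_int (esign \<Gamma> {v, c}) else 0)" for c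
    using vu by (auto simp: s_def row_def adj_matrix_def axis_def insert_commute)
  have w: "w $ c = (if c = u then 1 else if c = v then -1 else 0)" for c
    using ne by (simp add: w_def axis_def)
  have A': "adj_matrix (alpha \<Gamma> u v) $ a $ b =
    (if {a, b} \<in> edges (alpha \<Gamma> u v) then of_int (esign (alpha \<Gamma> u v) {a, b}) else 0)"
    by (simp add: adj_matrix_def)
  show ?thesis
    unfolding A' alpha_edge_iff[OF ne loops tri uv] alpha_esign[OF ne] s w
    using ne loops vu uv tri'[of a] tri'[of b]
    \<comment> \<open>Only the positions of \<open>a\<close> and \<open>b\<close> relative to
      \<open>u\<close> and \<open>v\<close> matter; \<open>tri'\<close> excludes a clash of an old
      edge with a moved one.\<close>
    by (cases "a = u"; cases "a = v"; cases "b = u"; cases "b = v")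
      (simp_all add: adj_matrix_def insert_commute)
qed

text \<open>The rank-two update contributes \<open>2 (w \<bullet> y) (s \<bullet> y)\<close>, and
  both inner products are explicit.\<close>

lemma inner_alpha:
  fixes \<Gamma> :: "'v::finite signed_graph" and y :: "real ^ 'v"
  assumes "is_signed_graph \<Gamma>" "{u, v} \<in> edges \<Gamma>" "\<not> in_triangle \<Gamma> u v"
  shows "y \<bullet> (adj_matrix (alpha \<Gamma> u v) *v y) = y \<bullet> (adj_matrix \<Gamma> *v y)
    + 2 * (y $ u - y $ v) * ((adj_matrix \<Gamma> *v y) $ v - of_int (esign \<Gamma> {u, v}) * y $ u)"
proof -
  define s where "s = row v (adj_matrix \<Gamma>) - of_int (esign \<Gamma> {u, v}) *\<^sub>R axis u 1"
  define w where "w = (axis u 1 - axis v 1 :: real ^ 'v)"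
  have "(adj_matrix (alpha \<Gamma> u v) *v y) $ a
      = (adj_matrix \<Gamma> *v y) $ a + w $ a * (s \<bullet> y) + s $ a * (w \<bullet> y)" for a
    by (simp add: matrix_vector_mult_def adj_matrix_alpha[OF assms] inner_vec_def
        sum.distrib sum_distrib_left algebra_simps flip: s_def w_def)
  then have "adj_matrix (alpha \<Gamma> u v) *v y = adj_matrix \<Gamma> *v y + (s \<bullet> y) *\<^sub>R w + (w \<bullet> y) *\<^sub>R s"
    by (simp add: vec_eq_iff mult.commute)
  moreover have "s \<bullet> y = (adj_matrix \<Gamma> *v y) $ v - of_int (esign \<Gamma> {u, v}) * y $ u"
    by (simp add: s_def inner_diff_left inner_axis' matrix_vector_mul_component row_def)
  moreover have "w \<bullet> y = y $ u - y $ v"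
    by (simp add: w_def inner_diff_left inner_axis')
  ultimately show ?thesis
    by (simp add: inner_add_right inner_commute[of y])
qed

text \<open>Exchanging the labels \<open>u\<close> and \<open>v\<close> turns
  \<open>alpha \<Gamma> u v\<close> into \<open>alpha \<Gamma> v u\<close>. Hence \<open>y\<close>,
  which is \<open>x\<close> with these two entries swapped, yields the formula of
  \<open>inner_alpha\<close> with \<open>u\<close> and \<open>v\<close> interchanged.\<close>

lemma inner_alpha_swap:
  fixes \<Gamma> :: "'v::finite signed_graph" and x :: "real ^ 'v"
  assumes sg: "is_signed_graph \<Gamma>" and uv: "{u, v} \<in> edges \<Gamma>" and tri: "\<not> in_triangle \<Gamma> u v"
  defines "y \<equiv> x + (x $ v - x $ u) *\<^sub>R (axis u 1 - axis v 1)"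
  shows "y \<bullet> y = x \<bullet> x"
    and "y \<bullet> (adj_matrix (alpha \<Gamma> u v) *v y) = x \<bullet> (adj_matrix \<Gamma> *v x)
      + 2 * (x $ v - x $ u) * ((adj_matrix \<Gamma> *v x) $ u - of_int (esign \<Gamma> {u, v}) * x $ v)"
proof -
  have ne: "u \<noteq> v" using uv no_loop[OF sg] by auto
  define A where "A = adj_matrix \<Gamma>"
  define \<sigma> where "\<sigma> = (of_int (esign \<Gamma> {u, v}) :: real)"
  define d where "d = x $ v - x $ u"
  define w where "w = (axis u 1 - axis v 1 :: real ^ 'v)"
  have y: "y = x + d *\<^sub>R w" by (simp add: y_def d_def w_def)
  have w_inner: "w \<bullet> z = z $ u - z $ v" for z
    by (simp add: w_def inner_diff_left inner_axis')
  have w_uv: "w $ u = 1" "w $ v = -1" using ne by (auto simp: w_def axis_def)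
  show "y \<bullet> y = x \<bullet> x"
    by (simp add: y inner_add inner_commute[of x w] w_inner w_uv d_def algebra_simps)
  \<comment> \<open>Only the entries of \<open>A\<close> at \<open>u\<close> and \<open>v\<close>
    enter: the diagonal ones are 0 and the other two are \<open>\<sigma>\<close>.\<close>
  have Aw: "(A *v w) $ u = - \<sigma>" "(A *v w) $ v = \<sigma>"
    using uv adj_matrix_diag[OF sg]
    by (simp_all add: w_def A_def \<sigma>_def matrix_vector_mult_diff_distrib matrix_vector_mult_basis
        column_def) (simp_all add: adj_matrix_def insert_commute)
  have "x \<bullet> (A *v w) = (A *v x) $ u - (A *v x) $ v"
    using symmetric_matrix_inner[of A x w] by (simp add: A_def adj_matrix_symmetric w_inner)
  moreover have "A *v y = A *v x + d *\<^sub>R (A *v w)"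
    by (simp add: y matrix_vector_right_distrib matrix_vector_mult_scaleR)
  ultimately show "y \<bullet> (adj_matrix (alpha \<Gamma> u v) *v y) = x \<bullet> (adj_matrix \<Gamma> *v x)
      + 2 * (x $ v - x $ u) * ((adj_matrix \<Gamma> *v x) $ u - of_int (esign \<Gamma> {u, v}) * x $ v)"
    unfolding inner_alpha[OF sg uv tri] A_def[symmetric] \<sigma>_def[symmetric] d_def[symmetric]
    by (simp add: y inner_add w_inner w_uv Aw) (simp add: d_def algebra_simps)
qed

section \<open>Comparison of the two indices\<close>

theorem lemma2p5:
  fixes \<Gamma> \<Gamma>' :: "'v::finite signed_graph"
    and u v :: 'v
    and x :: "real ^ 'v"
  assumes "is_signed_graph \<Gamma>"
    and "connected_graph \<Gamma>"
    and "{u, v} \<in> edges \<Gamma>"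
    and "\<not> pendant_edge \<Gamma> u v"
    and "\<not> in_triangle \<Gamma> u v"
    and "\<Gamma>' = alpha \<Gamma> u v"
    and "eigenvector (adj_matrix \<Gamma>) x (graph_index \<Gamma>)"
  shows
    "((esign \<Gamma> {u, v} > 0 \<and> x $ v \<le> x $ u \<and> x $ u \<le> graph_index \<Gamma> * x $ v) \<or>
      (esign \<Gamma> {u, v} < 0 \<and> x $ u \<ge> 0 \<and> x $ v \<ge> 0)
        \<longrightarrow> graph_index \<Gamma>' \<ge> graph_index \<Gamma>) \<and>
     ((esign \<Gamma> {u, v} > 0 \<and> x $ v < x $ u \<and> x $ u < graph_index \<Gamma> * x $ v) \<or>
      (esign \<Gamma> {u, v} < 0 \<and> x $ u > 0 \<and> x $ v > 0 \<and> x $ u \<noteq> x $ v)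
        \<longrightarrow> graph_index \<Gamma>' > graph_index \<Gamma>)"
proof -
  note graph = assms(1,3,5)
  define A where "A = adj_matrix \<Gamma>"
  define l where "l = graph_index \<Gamma>"
  define l' where "l' = graph_index \<Gamma>'"
  define \<sigma> where "\<sigma> = (of_int (esign \<Gamma> {u, v}) :: real)"
  have x: "x \<noteq> 0" "A *v x = l *\<^sub>R x"
    using assms(7) by (auto simp: eigenvector_def A_def l_def)
  have xx: "x \<bullet> x > 0" using x(1) by simp
  have l: "l \<ge> 0" unfolding l_def by (rule graph_index_nonneg[OF assms(1)])
  have sign: "esign \<Gamma> {u, v} = 1 \<or> esign \<Gamma> {u, v} = -1"
    using assms(1,3) by (auto simp: is_signed_graph_def)
  \<comment> \<open>The Rayleigh bound at \<open>x\<close> itself, with \<open>A x = l x\<close>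
    substituted both in the quadratic form and in the entry at \<open>v\<close>.\<close>
  have bound1: "2 * ((x $ u - x $ v) * (l * x $ v - \<sigma> * x $ u)) \<le> (l' - l) * (x \<bullet> x)"
    using rayleigh_le_graph_index[of x \<Gamma>'] inner_alpha[OF graph, of x]
    by (simp add: assms(6) x flip: A_def l'_def \<sigma>_def) (simp add: algebra_simps l'_def assms(6))
  define y where "y = x + (x $ v - x $ u) *\<^sub>R (axis u 1 - axis v 1)"
  \<comment> \<open>The same for the swapped vector, whose norm is that of \<open>x\<close>; this
    reverses the sign of the first factor.\<close>
  have bound2: "2 * ((x $ v - x $ u) * (l * x $ u - \<sigma> * x $ v)) \<le> (l' - l) * (x \<bullet> x)"
    using rayleigh_le_graph_index[of y \<Gamma>'] inner_alpha_swap[OF graph, of x]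
    by (simp add: assms(6) x flip: A_def l'_def \<sigma>_def y_def) (simp add: algebra_simps l'_def assms(6))
  have weak: "l \<le> l'" if "0 \<le> (l' - l) * (x \<bullet> x)"
    using that xx by (simp add: zero_le_mult_iff)
  have strict: "l < l'" if "0 < (l' - l) * (x \<bullet> x)"
    using that xx by (simp add: zero_less_mult_iff)
  have "l \<le> l'" if "esign \<Gamma> {u, v} > 0" "x $ v \<le> x $ u" "x $ u \<le> l * x $ v"
  proof (rule weak)
    have "0 \<le> (x $ u - x $ v) * (l * x $ v - \<sigma> * x $ u)"
      using sign that by (intro mult_nonneg_nonneg) (auto simp: \<sigma>_def)
    with bound1 show "0 \<le> (l' - l) * (x \<bullet> x)" by linarith
  qed
  moreover have "l < l'" if "esign \<Gamma> {u, v} > 0" "x $ v < x $ u" "x $ u < l * x $ v"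
  proof (rule strict)
    have "0 < (x $ u - x $ v) * (l * x $ v - \<sigma> * x $ u)"
      using sign that by (intro mult_pos_pos) (auto simp: \<sigma>_def)
    with bound1 show "0 < (l' - l) * (x \<bullet> x)" by linarith
  qed
  moreover have "l \<le> l'" if "esign \<Gamma> {u, v} < 0" "x $ u \<ge> 0" "x $ v \<ge> 0"
  proof (rule weak)
    \<comment> \<open>With \<open>\<sigma> = -1\<close> both second factors are sums of nonnegative
      terms, so the order of \<open>x $ u\<close> and \<open>x $ v\<close> decides which test vector
      serves.\<close>
    have "0 \<le> (x $ u - x $ v) * (l * x $ v - \<sigma> * x $ u) \<or>
          0 \<le> (x $ v - x $ u) * (l * x $ u - \<sigma> * x $ v)"
      using sign that l by (cases "x $ v \<le> x $ u") (auto simp: \<sigma>_def)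
    with bound1 bound2 show "0 \<le> (l' - l) * (x \<bullet> x)" by linarith
  qed
  moreover have "l < l'" if "esign \<Gamma> {u, v} < 0" "x $ u > 0" "x $ v > 0" "x $ u \<noteq> x $ v"
  proof (rule strict)
    \<comment> \<open>Here \<open>- \<sigma>\<close> times an entry is positive and \<open>l\<close>
      is nonnegative, so strictness survives even for \<open>l = 0\<close>.\<close>
    have "0 < l * x $ v - \<sigma> * x $ u" "0 < l * x $ u - \<sigma> * x $ v"
      using sign that l by (auto simp: \<sigma>_def add_nonneg_pos)
    then have "0 < (x $ u - x $ v) * (l * x $ v - \<sigma> * x $ u) \<or>
               0 < (x $ v - x $ u) * (l * x $ u - \<sigma> * x $ v)"
      using that(4) by (auto simp: zero_less_mult_iff)
    with bound1 bound2 show "0 < (l' - l) * (x \<bullet> x)" by linarith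
  qed
  ultimately show ?thesis by (auto simp flip: l_def l'_def)
qed

end
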